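(* Let $(X,d)$ be an ultrametric space and let $J_\omega(X)$ be the set of max-min measures of finite support on $X$. Then the function $\hat d$ on $J_\omega(X)\times J_\omega(X)$ given by $$\hat d(\mu,\nu)=\inf\{r>0\mid \mu(\varphi)=\nu(\varphi)\text{ for all }\varphi\in\mathcal F_r(X)\}$$ is an ultrametric on $J_\omega(X)$.
   Context: On the extended real line $\bar{\mathbb R}=\mathbb R\cup\{-\infty,\infty\}$, $\vee$ denotes maximum and $\wedge$ denotes minimum. For a topological space $X$, $C(X)$ is the set of continuous real-valued functions on $X$. Given $x_1,\dots,x_n\in X$ and $\alpha_1,\dots,\alpha_n\in\bar{\mathbb R}$ ($n\ge 1$) with $\vee_{i=1}^n\alpha_i=\infty$, the symbol $\vee_{i=1}^n\alpha_i\wedge\delta_{x_i}$ denotes the functional $C(X)\to\mathbb R$, $\varphi\mapsto\vee_{i=1}^n\big(\alpha_i\wedge\varphi(x_i)\big)$. $J_\omega(X)$ is the set of all such functionals (max-min measures of finite support on $X$). For an ultrametric space $(X,d)$ and $r>0$, $O_r(x)=\{y\in X\mid d(x,y)<r\}$; the sets $O_r(x)$, $x\in X$, partition $X$. $\mathcal F_r(X)$ is the set of all functions $X\to\mathbb R$ that are constant on each set $O_r(x)$ (such functions are continuous). *)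

theory Defs
  imports "HOL-Analysis.Analysis"
begin

locale Ultrametric_space = Metric_space +
  assumes ultra: "\<And>x y z. \<lbrakk>x \<in> M; y \<in> M; z \<in> M\<rbrakk> \<Longrightarrow> d x z \<le> max (d x y) (d y z)"

context Metric_space
begin

(* Functions on the carrier M are extensional, so that equality of functions
   is equality of their values on M; likewise functionals on C(M) are extensional on C(M). *)
definition cont_funs :: "('a \<Rightarrow> real) set" where
  "cont_funs = {\<phi> \<in> extensional M. continuous_map mtopology euclideanreal \<phi>}"

(* The extended real maximum is finite when the maximum of the coefficients is \<infinity>
   (see ereal_maxmin_functional), so real_of_ereal loses nothing in that case. *)
definition maxmin_functional ::
    "nat \<Rightarrow> (nat \<Rightarrow> ereal) \<Rightarrow> (nat \<Rightarrow> 'a) \<Rightarrow> ('a \<Rightarrow> real) \<Rightarrow> real" where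
  "maxmin_functional n \<alpha> x =
     (\<lambda>\<phi>\<in>cont_funs. real_of_ereal (MAX i\<in>{1..n}. min (\<alpha> i) (ereal (\<phi> (x i)))))"

definition maxmin_measures :: "(('a \<Rightarrow> real) \<Rightarrow> real) set" where
  "maxmin_measures =
     {maxmin_functional n \<alpha> x | n \<alpha> x.
        1 \<le> n \<and> (\<forall>i\<in>{1..n}. x i \<in> M) \<and> (MAX i\<in>{1..n}. \<alpha> i) = \<infinity>}"

definition ball_const_funs :: "real \<Rightarrow> ('a \<Rightarrow> real) set" where
  "ball_const_funs r = {\<phi> \<in> extensional M. \<forall>x\<in>M. \<phi> constant_on mball x r}"

(* Metric_space demands nonnegativity and symmetry on the whole type, hence the value 0
   outside the carrier maxmin_measures. *)
definition maxmin_dist ::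
    "(('a \<Rightarrow> real) \<Rightarrow> real) \<Rightarrow> (('a \<Rightarrow> real) \<Rightarrow> real) \<Rightarrow> real" where
  "maxmin_dist \<mu> \<nu> =
     (if \<mu> \<in> maxmin_measures \<and> \<nu> \<in> maxmin_measures
      then Inf {r. 0 < r \<and> (\<forall>\<phi>\<in>ball_const_funs r. \<mu> \<phi> = \<nu> \<phi>)} else 0)"

lemma ereal_maxmin_functional:
  assumes "1 \<le> n" "(MAX i\<in>{1..n}. \<alpha> i) = \<infinity>" "\<phi> \<in> cont_funs"
  shows "ereal (maxmin_functional n \<alpha> x \<phi>) = (MAX i\<in>{1..n}. min (\<alpha> i) (ereal (\<phi> (x i))))"
proof -
  let ?g = "\<lambda>i. min (\<alpha> i) (ereal (\<phi> (x i)))"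
  have ne: "finite (?g ` {1..n})" "?g ` {1..n} \<noteq> {}" "finite (\<alpha> ` {1..n})" "\<alpha> ` {1..n} \<noteq> {}"
    using assms(1) by auto
  obtain j where j: "j \<in> {1..n}" "\<alpha> j = \<infinity>"
    using Max_in[OF ne(3,4)] assms(2) by auto
  have "?g j \<le> (MAX i\<in>{1..n}. ?g i)"
    using ne(1) j(1) by (intro Max_ge) auto
  then have lower: "(MAX i\<in>{1..n}. ?g i) \<noteq> -\<infinity>"
    using j(2) by auto
  obtain k where "(MAX i\<in>{1..n}. ?g i) = ?g k"
    using Max_in[OF ne(1,2)] by blast
  then have "(MAX i\<in>{1..n}. ?g i) \<le> ereal (\<phi> (x k))"
    by simp
  then have "(MAX i\<in>{1..n}. ?g i) \<noteq> \<infinity>"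
    by auto
  with lower have "\<bar>MAX i\<in>{1..n}. ?g i\<bar> \<noteq> \<infinity>"
    by auto
  then show ?thesis
    using assms(3) by (simp add: maxmin_functional_def ereal_real')
qed

lemma ball_const_funs_subset_cont_funs:
  assumes "0 < r"
  shows "ball_const_funs r \<subseteq> cont_funs"
proof
  fix \<phi> assume \<phi>: "\<phi> \<in> ball_const_funs r"
  have eq: "\<phi> y = \<phi> x" if "x \<in> M" "y \<in> mball x r" for x y
  proof -
    from \<phi> that(1) obtain c where "\<forall>z\<in>mball x r. \<phi> z = c"
      unfolding ball_const_funs_def constant_on_def by blast
    then show ?thesis
      using that assms by (metis centre_in_mball_iff)
  qed
  have "continuous_map mtopology euclideanreal \<phi>"
    unfolding continuous_map_def
  proof (intro conjI allI impI)
    fix U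
    show "openin mtopology {x \<in> topspace mtopology. \<phi> x \<in> U}"
      unfolding openin_mtopology
    proof (intro conjI allI impI)
      fix x assume x: "x \<in> {x \<in> topspace mtopology. \<phi> x \<in> U}"
      then have "mball x r \<subseteq> {x \<in> topspace mtopology. \<phi> x \<in> U}"
        using eq by fastforce
      with assms show "\<exists>r>0. mball x r \<subseteq> {x \<in> topspace mtopology. \<phi> x \<in> U}"
        by blast
    qed auto
  qed auto
  with \<phi> show "\<phi> \<in> cont_funs"
    by (simp add: cont_funs_def ball_const_funs_def)
qed

end

end

theory Submission
  imports Defs
begin

text \<open>A max-min measure of finite support only sees the values of a function on a finite set, and
  its value on a function that is constant there is that constant. Two finite supports lie in a
  single ball of large radius, which makes the infimum range over a nonempty set; and for \<open>r\<close> below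
  the minimal distance in the union of the supports every function agrees on this union
  with one that is constant on \<open>r\<close>-balls, which gives separation. The ultrametric inequality holds
  because the spaces of functions constant on \<open>r\<close>-balls decrease with \<open>r\<close>.\<close>

context Metric_space
begin

text \<open>The set \<open>F\<close> consists of the points \<open>x i\<close>, and only the values
  \<open>\<phi> (x i)\<close> enter the maximum. Some coefficient is \<infinity> because a finite
  maximum is attained; its term equals \<open>c\<close> when \<open>\<phi>\<close> is
  \<open>c\<close> on \<open>F\<close>, and no term exceeds \<open>c\<close>.\<close>

lemma maxmin_measure_supportE:
  assumes "\<mu> \<in> maxmin_measures"
  obtains F where "finite F" "F \<noteq> {}" "F \<subseteq> M"
    "\<And>\<phi> \<psi>. \<lbrakk>\<phi> \<in> cont_funs; \<psi> \<in> cont_funs; \<And>x. x \<in> F \<Longrightarrow> \<phi> x = \<psi> x\<rbrakk> \<Longrightarrow> \<mu> \<phi> = \<mu> \<psi>"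
    "\<And>\<phi> c. \<lbrakk>\<phi> \<in> cont_funs; \<And>x. x \<in> F \<Longrightarrow> \<phi> x = c\<rbrakk> \<Longrightarrow> \<mu> \<phi> = c"
proof -
  obtain n \<alpha> x where \<mu>: "\<mu> = maxmin_functional n \<alpha> x" and n: "1 \<le> n"
    and x: "\<And>i. i \<in> {1..n} \<Longrightarrow> x i \<in> M" and top: "(MAX i\<in>{1..n}. \<alpha> i) = \<infinity>"
    using assms unfolding maxmin_measures_def by auto
  show thesis
  proof (rule that[of "x ` {1..n}"])
    fix \<phi> \<psi>
    assume *: "\<phi> \<in> cont_funs" "\<psi> \<in> cont_funs" "\<And>y. y \<in> x ` {1..n} \<Longrightarrow> \<phi> y = \<psi> y"
    then have "(\<lambda>i. min (\<alpha> i) (ereal (\<phi> (x i)))) ` {1..n} =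
        (\<lambda>i. min (\<alpha> i) (ereal (\<psi> (x i)))) ` {1..n}"
      by (intro image_cong) auto
    with * show "\<mu> \<phi> = \<mu> \<psi>"
      by (simp add: \<mu> maxmin_functional_def)
  next
    fix \<phi> c
    assume \<phi>: "\<phi> \<in> cont_funs" and c: "\<And>y. y \<in> x ` {1..n} \<Longrightarrow> \<phi> y = c"
    have "\<infinity> \<in> \<alpha> ` {1..n}"
      using Max_in[of "\<alpha> ` {1..n}"] n by (simp flip: top)
    then obtain j where j: "j \<in> {1..n}" "\<alpha> j = \<infinity>"
      by auto
    have "(MAX i\<in>{1..n}. min (\<alpha> i) (ereal (\<phi> (x i)))) = ereal c"
    proof (rule Max_eqI)
      show "ereal c \<in> (\<lambda>i. min (\<alpha> i) (ereal (\<phi> (x i)))) ` {1..n}"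
        using j c by (intro image_eqI[of _ _ j]) auto
    qed (use c in auto)
    then show "\<mu> \<phi> = c"
      using \<phi> by (simp add: \<mu> maxmin_functional_def)
  qed (use n x in auto)
qed

text \<open>Reduces equality of two measures to equality of their values on
  \<open>cont_funs\<close>, which is how separation is proved.\<close>

lemma maxmin_measures_subset_extensional: "maxmin_measures \<subseteq> extensional cont_funs"
  by (auto simp: maxmin_measures_def maxmin_functional_def)

lemma ball_const_funs_antimono:
  assumes "r \<le> s"
  shows "ball_const_funs s \<subseteq> ball_const_funs r"
proof -
  have "\<phi> constant_on mball x r" if "\<phi> constant_on mball x s" for \<phi> :: "'a \<Rightarrow> real" and x
    using that mball_subset_concentric[OF assms] by (rule constant_on_subset)
  then show ?thesis
    by (simp add: ball_const_funs_def Collect_mono)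
qed

lemma finite_imp_separated:
  assumes "finite F" "F \<subseteq> M"
  obtains r where "0 < r" "\<And>x y. \<lbrakk>x \<in> F; y \<in> F; d x y < r\<rbrakk> \<Longrightarrow> x = y"
proof -
  \<comment> \<open>The element \<open>1\<close> keeps \<open>D\<close> nonempty when
    \<open>F\<close> has at most one point.\<close>
  define D where "D = insert 1 {d x y |x y. x \<in> F \<and> y \<in> F \<and> x \<noteq> y}"
  have "D \<subseteq> insert 1 ((\<lambda>(x, y). d x y) ` (F \<times> F))"
    by (auto simp: D_def)
  then have fin: "finite D" "D \<noteq> {}"
    using assms(1) by (auto intro: finite_subset simp: D_def)
  show thesis
  proof (rule that[of "Min D"])
    show "0 < Min D"
      unfolding Min_gr_iff[OF fin] using assms(2) by (auto simp: D_def intro!: mdist_pos_less)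
    fix x y assume "x \<in> F" "y \<in> F" "d x y < Min D"
    moreover have "Min D \<le> d x y" if "x \<in> F" "y \<in> F" "x \<noteq> y"
      using fin that by (intro Min_le) (auto simp: D_def)
    ultimately show "x = y"
      by fastforce
  qed
qed

text \<open>This is the set whose infimum is \<open>maxmin_dist\<close>, freed from the case
  distinction on membership in \<open>maxmin_measures\<close>.\<close>

definition agreement_radii :: "(('a \<Rightarrow> real) \<Rightarrow> real) \<Rightarrow> (('a \<Rightarrow> real) \<Rightarrow> real) \<Rightarrow> real set" where
  "agreement_radii \<mu> \<nu> = {r. 0 < r \<and> (\<forall>\<phi>\<in>ball_const_funs r. \<mu> \<phi> = \<nu> \<phi>)}"

lemma maxmin_dist_eq_Inf:
  assumes "\<mu> \<in> maxmin_measures" "\<nu> \<in> maxmin_measures"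
  shows "maxmin_dist \<mu> \<nu> = Inf (agreement_radii \<mu> \<nu>)"
  using assms by (simp add: maxmin_dist_def agreement_radii_def)

lemma bdd_below_agreement_radii: "bdd_below (agreement_radii \<mu> \<nu>)"
  by (rule bdd_belowI[of _ 0]) (simp add: agreement_radii_def)

lemma agreement_radii_upward:
  assumes "r \<in> agreement_radii \<mu> \<nu>" "r \<le> s"
  shows "s \<in> agreement_radii \<mu> \<nu>"
  using assms ball_const_funs_antimono[of r s] by (auto simp: agreement_radii_def)

lemma agreement_radii_nonempty:
  assumes "\<mu> \<in> maxmin_measures" "\<nu> \<in> maxmin_measures"
  shows "agreement_radii \<mu> \<nu> \<noteq> {}"
proof -
  obtain F where F: "finite F" "F \<noteq> {}" "F \<subseteq> M"
    "\<And>\<phi> c. \<lbrakk>\<phi> \<in> cont_funs; \<And>x. x \<in> F \<Longrightarrow> \<phi> x = c\<rbrakk> \<Longrightarrow> \<mu> \<phi> = c"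
    using maxmin_measure_supportE[OF assms(1)] by metis
  obtain G where G: "finite G" "G \<subseteq> M"
    "\<And>\<phi> c. \<lbrakk>\<phi> \<in> cont_funs; \<And>x. x \<in> G \<Longrightarrow> \<phi> x = c\<rbrakk> \<Longrightarrow> \<nu> \<phi> = c"
    using maxmin_measure_supportE[OF assms(2)] by metis
  obtain a where a: "a \<in> F" "a \<in> M"
    using F(2,3) by auto
  \<comment> \<open>The summand \<open>1\<close> makes the bound strict, since \<open>mball\<close>
    is open; it also puts \<open>F \<union> G\<close> inside one ball around \<open>a\<close>, where
    both measures return the constant value of \<open>\<phi>\<close>.\<close>
  define r where "r = Max (d a ` (F \<union> G)) + 1"
  have ar: "d a x < r" if "x \<in> F \<union> G" for x
  proof -
    have "d a x \<le> Max (d a ` (F \<union> G))"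
      using that F(1) G(1) by (intro Max_ge) auto
    then show ?thesis by (simp add: r_def)
  qed
  have r: "0 < r"
    using ar[of a] a by simp
  have "\<mu> \<phi> = \<nu> \<phi>" if \<phi>: "\<phi> \<in> ball_const_funs r" for \<phi>
  proof -
    have cont: "\<phi> \<in> cont_funs"
      using \<phi> ball_const_funs_subset_cont_funs[OF r] by blast
    obtain c where c: "\<And>x. x \<in> mball a r \<Longrightarrow> \<phi> x = c"
      using \<phi> a by (auto simp: ball_const_funs_def constant_on_def)
    have c': "\<phi> x = c" if "x \<in> F \<union> G" for x
      using that ar a F(3) G(2) by (intro c) auto
    have "\<mu> \<phi> = c" using c' by (intro F(4) cont) auto
    moreover have "\<nu> \<phi> = c" using c' by (intro G(3) cont) auto
    ultimately show ?thesis by simp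
  qed
  then have "r \<in> agreement_radii \<mu> \<nu>"
    using r by (simp add: agreement_radii_def)
  then show ?thesis by blast
qed

text \<open>An agreement radius lies strictly between the infimum and \<open>r\<close>, or at the
  infimum, and upward closure carries it to \<open>r\<close>. Later arguments thus never ask whether
  the infimum is attained.\<close>

lemma maxmin_dist_less_imp_agreement:
  assumes "\<mu> \<in> maxmin_measures" "\<nu> \<in> maxmin_measures" "maxmin_dist \<mu> \<nu> < r"
  shows "r \<in> agreement_radii \<mu> \<nu>"
proof -
  obtain s where "s \<in> agreement_radii \<mu> \<nu>" "s < r"
    using assms cInf_less_iff[OF agreement_radii_nonempty[OF assms(1,2)] bdd_below_agreement_radii]
    by (auto simp: maxmin_dist_eq_Inf)
  then show ?thesis
    by (auto intro: agreement_radii_upward)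
qed

lemma maxmin_dist_le:
  assumes "\<mu> \<in> maxmin_measures" "\<nu> \<in> maxmin_measures" "r \<in> agreement_radii \<mu> \<nu>"
  shows "maxmin_dist \<mu> \<nu> \<le> r"
  using assms by (simp add: maxmin_dist_eq_Inf cInf_lower bdd_below_agreement_radii)

lemma maxmin_dist_nonneg: "0 \<le> maxmin_dist \<mu> \<nu>"
proof (cases "\<mu> \<in> maxmin_measures \<and> \<nu> \<in> maxmin_measures")
  case True
  then show ?thesis
    using agreement_radii_nonempty
    by (auto simp: maxmin_dist_eq_Inf agreement_radii_def intro!: cInf_greatest)
qed (auto simp: maxmin_dist_def)

lemma maxmin_dist_commute: "maxmin_dist \<mu> \<nu> = maxmin_dist \<nu> \<mu>"
proof -
  have "agreement_radii \<mu> \<nu> = agreement_radii \<nu> \<mu>"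
    by (auto simp: agreement_radii_def)
  then show ?thesis
    unfolding maxmin_dist_def agreement_radii_def by (simp only: conj_commute)
qed

lemma maxmin_dist_ultra:
  assumes "\<mu> \<in> maxmin_measures" "\<nu> \<in> maxmin_measures" "\<kappa> \<in> maxmin_measures"
  shows "maxmin_dist \<mu> \<kappa> \<le> max (maxmin_dist \<mu> \<nu>) (maxmin_dist \<nu> \<kappa>)"
proof (rule dense_ge)
  \<comment> \<open>Any \<open>r\<close> strictly above both distances is an agreement radius for
    both pairs; at this common radius agreement is transitive.\<close>
  fix r assume "max (maxmin_dist \<mu> \<nu>) (maxmin_dist \<nu> \<kappa>) < r"
  then have "r \<in> agreement_radii \<mu> \<nu>" "r \<in> agreement_radii \<nu> \<kappa>"
    using assms by (auto intro: maxmin_dist_less_imp_agreement)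
  then have "r \<in> agreement_radii \<mu> \<kappa>"
    by (simp add: agreement_radii_def)
  with assms show "maxmin_dist \<mu> \<kappa> \<le> r"
    by (intro maxmin_dist_le)
qed

lemma maxmin_dist_self:
  assumes "\<mu> \<in> maxmin_measures"
  shows "maxmin_dist \<mu> \<mu> = 0"
proof (rule antisym)
  show "maxmin_dist \<mu> \<mu> \<le> 0"
  proof (rule dense_ge)
    fix r :: real assume "0 < r"
    with assms show "maxmin_dist \<mu> \<mu> \<le> r"
      by (intro maxmin_dist_le) (simp_all add: agreement_radii_def)
  qed
qed (rule maxmin_dist_nonneg)

end

context Ultrametric_space
begin

text \<open>By the ultrametric inequality for \<open>d\<close>, two balls of equal radius coincide
  once each contains the centre of the other. Hence a function defined through the set
  \<open>mball y r\<close> alone is constant on balls of radius \<open>r\<close>.\<close>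

lemma mball_eq_mball:
  assumes "y \<in> mball x r"
  shows "mball y r = mball x r"
proof -
  have "mball v r \<subseteq> mball u r" if "u \<in> M" "v \<in> M" "d u v < r" for u v
    using that ultra[of u v] by fastforce
  with assms commute show ?thesis
    by (metis in_mball subset_antisym)
qed

lemma ball_const_funs_interpolate:
  assumes "finite F" "F \<subseteq> M"
  obtains r \<psi> where "0 < r" "\<psi> \<in> ball_const_funs r" "\<And>x. x \<in> F \<Longrightarrow> \<psi> x = \<phi> x"
proof -
  obtain r where r: "0 < r" "\<And>x y. \<lbrakk>x \<in> F; y \<in> F; d x y < r\<rbrakk> \<Longrightarrow> x = y"
    using finite_imp_separated[OF assms] by blast
  \<comment> \<open>Each ball receives the value of \<open>\<phi>\<close> at a chosen point of
    \<open>F\<close> in it. If the ball misses \<open>F\<close>, \<open>SOME\<close> still depends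
    only on the ball, so \<open>\<psi>\<close> remains constant there.\<close>
  define \<psi> where "\<psi> = (\<lambda>y\<in>M. \<phi> (SOME x. x \<in> F \<inter> mball y r))"
  show thesis
  proof (rule that[OF r(1)])
    have "\<psi> constant_on mball x r" for x
      unfolding constant_on_def
    proof (intro exI ballI)
      fix y assume y: "y \<in> mball x r"
      then have "y \<in> M"
        by simp
      then show "\<psi> y = \<phi> (SOME z. z \<in> F \<inter> mball x r)"
        by (simp only: \<psi>_def restrict_apply' mball_eq_mball[OF y])
    qed
    then show "\<psi> \<in> ball_const_funs r"
      by (simp add: ball_const_funs_def \<psi>_def)
    fix x assume x: "x \<in> F"
    \<comment> \<open>As \<open>r\<close> separates the points of \<open>F\<close>, the choice is
      forced to be \<open>x\<close>.\<close>
    then have "F \<inter> mball x r = {x}"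
      using r assms(2) by fastforce
    then show "\<psi> x = \<phi> x"
      using x assms(2) by (auto simp only: \<psi>_def restrict_apply' singleton_iff some_eq_trivial)
  qed
qed

text \<open>An arbitrary continuous \<open>\<phi>\<close> is replaced by a ball-constant
  \<open>\<psi>\<close> that agrees with it on both supports, so neither measure notices the
  change.\<close>

lemma maxmin_dist_eq_0_imp_eq:
  assumes "\<mu> \<in> maxmin_measures" "\<nu> \<in> maxmin_measures" "maxmin_dist \<mu> \<nu> = 0"
  shows "\<mu> = \<nu>"
proof (rule extensionalityI)
  show "\<mu> \<in> extensional cont_funs" "\<nu> \<in> extensional cont_funs"
    using assms(1,2) maxmin_measures_subset_extensional by auto
  fix \<phi> assume \<phi>: "\<phi> \<in> cont_funs"
  obtain F where F: "finite F" "F \<subseteq> M"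
    "\<And>\<phi> \<psi>. \<lbrakk>\<phi> \<in> cont_funs; \<psi> \<in> cont_funs; \<And>x. x \<in> F \<Longrightarrow> \<phi> x = \<psi> x\<rbrakk> \<Longrightarrow> \<mu> \<phi> = \<mu> \<psi>"
    using maxmin_measure_supportE[OF assms(1)] by metis
  obtain G where G: "finite G" "G \<subseteq> M"
    "\<And>\<phi> \<psi>. \<lbrakk>\<phi> \<in> cont_funs; \<psi> \<in> cont_funs; \<And>x. x \<in> G \<Longrightarrow> \<phi> x = \<psi> x\<rbrakk> \<Longrightarrow> \<nu> \<phi> = \<nu> \<psi>"
    using maxmin_measure_supportE[OF assms(2)] by metis
  have "finite (F \<union> G)" "F \<union> G \<subseteq> M"
    using F(1,2) G(1,2) by auto
  then obtain r \<psi> where r: "0 < r" and \<psi>: "\<psi> \<in> ball_const_funs r"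
    and eq: "\<And>x. x \<in> F \<union> G \<Longrightarrow> \<psi> x = \<phi> x"
    by (rule ball_const_funs_interpolate[where \<phi> = \<phi>]) blast
  have cont: "\<psi> \<in> cont_funs"
    using \<psi> ball_const_funs_subset_cont_funs[OF r] by blast
  have "\<mu> \<phi> = \<mu> \<psi>"
    using eq by (intro F(3) \<phi> cont) auto
  \<comment> \<open>Distance zero lies below the positive \<open>r\<close>, so \<open>r\<close> is
    an agreement radius.\<close>
  also have "\<dots> = \<nu> \<psi>"
    using maxmin_dist_less_imp_agreement[OF assms(1,2)] assms(3) r \<psi>
    by (simp add: agreement_radii_def)
  also have "\<dots> = \<nu> \<phi>"
    using eq by (intro G(3) \<phi> cont) auto
  finally show "\<mu> \<phi> = \<nu> \<phi>" .
qed

lemma Ultrametric_space_maxmin: "Ultrametric_space maxmin_measures maxmin_dist"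
proof
  fix \<mu> \<nu> \<kappa>
  show "0 \<le> maxmin_dist \<mu> \<nu>"
    by (rule maxmin_dist_nonneg)
  show "maxmin_dist \<mu> \<nu> = maxmin_dist \<nu> \<mu>"
    by (rule maxmin_dist_commute)
  assume meas: "\<mu> \<in> maxmin_measures" "\<nu> \<in> maxmin_measures"
  show "maxmin_dist \<mu> \<nu> = 0 \<longleftrightarrow> \<mu> = \<nu>"
    using meas maxmin_dist_eq_0_imp_eq maxmin_dist_self by blast
  assume \<kappa>: "\<kappa> \<in> maxmin_measures"
  show ultra: "maxmin_dist \<mu> \<kappa> \<le> max (maxmin_dist \<mu> \<nu>) (maxmin_dist \<nu> \<kappa>)"
    by (rule maxmin_dist_ultra[OF meas \<kappa>])
  \<comment> \<open>The maximum of two nonnegative numbers is at most their sum, so the ultrametric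
    inequality yields the triangle inequality.\<close>
  then show "maxmin_dist \<mu> \<kappa> \<le> maxmin_dist \<mu> \<nu> + maxmin_dist \<nu> \<kappa>"
    using maxmin_dist_nonneg[of \<mu> \<nu>] maxmin_dist_nonneg[of \<nu> \<kappa>] by linarith
qed

end

theorem theorem3p1:
  fixes X :: "'a set" and d :: "'a \<Rightarrow> 'a \<Rightarrow> real"
  assumes "Ultrametric_space X d"
  shows "Ultrametric_space (Metric_space.maxmin_measures X d) (Metric_space.maxmin_dist X d)"
  using assms by (rule Ultrametric_space.Ultrametric_space_maxmin)

end
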